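(* Let $F=(a,b,c)$ be an indefinite binary quadratic form. Put $q_0:=\lfloor X(F)\rfloor$ and $$G_1:=\bigl(a,\;b+2aq_0,\;c+q_0(b+aq_0)\bigr),$$ and for each $j\in\mathbb{N}$ let $G_{j+1}$ be the K-successor form of $G_j$. Then the sequence $(G_j)_{j\in\mathbb{N}}$ of indefinite forms is eventually periodic, its period consists entirely of K-reduced forms, and the period always begins with the first K-reduced form that occurs in the sequence $(G_j)_{j\in\mathbb{N}}$.
   Context: $(a,b,c)$ with $a,b,c\in\mathbb{Z}$ denotes the binary quadratic form $ax^2+bxy+cy^2$, with discriminant $D=b^2-4ac$. It is called indefinite if $D>0$ and $D$ is not a perfect square (then $a\ne0$, $c\neq 0$). For an indefinite form $F=(a,b,c)$ put $X(F):=\frac{\sqrt{D}-b}{2a}$. K-successor form: for an indefinite form $G=(a,b,c)$ let $q:=\left\lfloor \frac{1}{X(G)}\right\rfloor$; the K-successor form of $G$ is $G'=(a',b',c')$ with $a'=-c$, $b'=-2cq-b$, $c'=q(-cq-b)-a$ (it is again indefinite, with the same discriminant). K-reduced: an indefinite form $G=(a,b,c)$ with discriminant $D$ and $f=\lfloor\sqrt{D}\rfloor$ is called K-reduced if $a>0$, $b>0$ and $f-\min(2a,2|c|)<b\le f$. *)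

theory Defs
  imports Complex_Main "HOL-Computational_Algebra.Nth_Powers"
begin

text \<open>The triple \<open>(a, b, c)\<close> stands for the binary quadratic form \<open>a x^2 + b x y + c y^2\<close>.\<close>

type_synonym bqf = "int \<times> int \<times> int"

fun discr :: "bqf \<Rightarrow> int" where
  "discr (a, b, c) = b\<^sup>2 - 4 * a * c"

definition indefinite :: "bqf \<Rightarrow> bool" where
  "indefinite F \<longleftrightarrow> discr F > 0 \<and> \<not> is_square (discr F)"

fun X :: "bqf \<Rightarrow> real" where
  "X (a, b, c) =
     (sqrt (real_of_int (discr (a, b, c))) - real_of_int b) / (2 * real_of_int a)"

fun first_form :: "bqf \<Rightarrow> bqf" where
  "first_form (a, b, c) =
     (let q = \<lfloor>X (a, b, c)\<rfloor> in (a, b + 2 * a * q, c + q * (b + a * q)))"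

fun K_successor :: "bqf \<Rightarrow> bqf" where
  "K_successor (a, b, c) =
     (let q = \<lfloor>1 / X (a, b, c)\<rfloor>
      in (- c, - 2 * c * q - b, q * (- c * q - b) - a))"

fun K_reduced :: "bqf \<Rightarrow> bool" where
  "K_reduced (a, b, c) \<longleftrightarrow> indefinite (a, b, c) \<and> a > 0 \<and> b > 0 \<and>
     (let f = \<lfloor>sqrt (real_of_int (discr (a, b, c)))\<rfloor>
      in f - min (2 * a) (2 * \<bar>c\<bar>) < b \<and> b \<le> f)"

text \<open>
  Sequences are indexed by the positive integers; the value at \<open>0\<close> is irrelevant.
  The period of an eventually periodic sequence is its shortest repeating block, taken
  at the earliest index from which the sequence is periodic (so the preperiod is also
  as short as possible). The definitions of \<open>period_start\<close>, \<open>period_length\<close> and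
  \<open>period\<close> are meaningful only for eventually periodic sequences.
\<close>

definition periodic_from :: "(nat \<Rightarrow> 'a) \<Rightarrow> nat \<Rightarrow> nat \<Rightarrow> bool" where
  "periodic_from s m p \<longleftrightarrow> 1 \<le> m \<and> 1 \<le> p \<and> (\<forall>j\<ge>m. s (j + p) = s j)"

definition eventually_periodic :: "(nat \<Rightarrow> 'a) \<Rightarrow> bool" where
  "eventually_periodic s \<longleftrightarrow> (\<exists>m p. periodic_from s m p)"

definition period_start :: "(nat \<Rightarrow> 'a) \<Rightarrow> nat" where
  "period_start s = (LEAST m. \<exists>p. periodic_from s m p)"

definition period_length :: "(nat \<Rightarrow> 'a) \<Rightarrow> nat" where
  "period_length s = (LEAST p. periodic_from s (period_start s) p)"

definition period :: "(nat \<Rightarrow> 'a) \<Rightarrow> 'a list" where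
  "period s = map s [period_start s ..< period_start s + period_length s]"

end

(* On roots, taking the K-successor is the Gauss map x |-> 1/x - floor (1/x), applied to X(G) and,
   with the same integer q, to the conjugate root. K-reduced means exactly 0 < X < 1 and
   conjugate root < -1. The map preserves K-reducedness and is injective on K-reduced forms, since
   q is recovered from the image as the floor of minus the conjugate root; as there are only finitely
   many K-reduced forms of a given discriminant, the sequence is periodic as soon as it reaches one.
   It does reach one: while both roots lie in (0,1), their product c/a does too, so |a| strictly
   decreases; as soon as the conjugate root leaves (0,1), at most two more steps suffice. *)

theory Submission
  imports Defs
begin

section \<open>The conjugate root, and the K-successor as a product of two substitutions\<close>

fun X_conj :: "bqf \<Rightarrow> real" where
  "X_conj (a, b, c) =
     (- sqrt (real_of_int (discr (a, b, c))) - real_of_int b) / (2 * real_of_int a)"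

text \<open>The substitution of \<open>x + q * y\<close> for \<open>x\<close>; it lowers both roots
  of \<open>a * t^2 + b * t + c\<close> by \<open>q\<close>.\<close>

fun shift :: "int \<Rightarrow> bqf \<Rightarrow> bqf" where
  "shift q (a, b, c) = (a, b + 2 * a * q, c + q * (b + a * q))"

text \<open>Exchange of the variables combined with a change of sign. The exchange alone would send
  \<open>X\<close> to the inverse of the conjugate root; the sign makes \<open>X\<close> go to
  \<open>1 / X\<close>.\<close>

fun flip :: "bqf \<Rightarrow> bqf" where
  "flip (a, b, c) = (- c, - b, - a)"

lemma first_form_eq_shift: "first_form G = shift \<lfloor>X G\<rfloor> G"
  by (cases G) (simp add: Let_def)

lemma K_successor_eq_shift_flip: "K_successor G = shift \<lfloor>1 / X G\<rfloor> (flip G)"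
  by (cases G) (simp add: Let_def algebra_simps)

lemma discr_shift [simp]: "discr (shift q G) = discr G"
  by (cases G) (simp add: algebra_simps power2_eq_square)

lemma discr_flip [simp]: "discr (flip G) = discr G"
  by (cases G) (simp add: algebra_simps)

lemma discr_K_successor [simp]: "discr (K_successor G) = discr G"
  by (simp add: K_successor_eq_shift_flip)

lemma indefinite_shift [simp]: "indefinite (shift q G) \<longleftrightarrow> indefinite G"
  by (simp add: indefinite_def)

lemma indefinite_K_successor [simp]: "indefinite (K_successor G) \<longleftrightarrow> indefinite G"
  by (simp add: indefinite_def)

lemma inj_shift: "inj (shift q)"
proof (rule injI)
  fix G H assume "shift q G = shift q H"
  then show "G = H" by (cases G; cases H) auto
qed

lemma inj_flip: "inj flip"
proof (rule injI)
  fix G H assume "flip G = flip H"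
  then show "G = H" by (cases G; cases H) auto
qed

section \<open>Irrationality of the roots and their transformation laws\<close>

lemma indefinite_sqrt_not_int:
  assumes "indefinite G"
  shows "sqrt (real_of_int (discr G)) \<noteq> real_of_int n"
proof
  assume "sqrt (real_of_int (discr G)) = real_of_int n"
  moreover have "(sqrt (real_of_int (discr G)))\<^sup>2 = real_of_int (discr G)"
    using assms by (simp add: indefinite_def)
  ultimately have "real_of_int (discr G) = real_of_int (n\<^sup>2)"
    by simp
  then have "discr G = n\<^sup>2"
    by (simp only: of_int_eq_iff)
  then show False
    using assms by (auto simp: indefinite_def is_nth_power_def)
qed

lemma indefinite_coeffs_nonzero:
  assumes "indefinite (a, b, c)"
  shows "a \<noteq> 0" "c \<noteq> 0"
  using assms by (auto simp: indefinite_def is_nth_power_def)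

lemma indefinite_sqrt_square:
  assumes "indefinite (a, b, c)"
  shows "(sqrt (real_of_int (discr (a, b, c))))\<^sup>2
    = (real_of_int b)\<^sup>2 - 4 * real_of_int a * real_of_int c"
proof -
  have "(sqrt (real_of_int (discr (a, b, c))))\<^sup>2 = real_of_int (discr (a, b, c))"
    using assms by (simp add: indefinite_def del: discr.simps)
  then show ?thesis by simp
qed

text \<open>A root equal to \<open>n\<close> would make the square root of the discriminant the
  integer \<open>b + 2 * a * n\<close>, up to sign. This is what makes the later bounds on
  fractional parts strict.\<close>

lemma X_not_int:
  assumes "indefinite G"
  shows "X G \<noteq> of_int n" "X_conj G \<noteq> of_int n"
proof -
  obtain a b c where G: "G = (a, b, c)" by (cases G)
  define s where "s = sqrt (real_of_int (discr G))"
  have "a \<noteq> 0" using assms indefinite_coeffs_nonzero G by blast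
  have "s \<noteq> of_int (b + 2 * a * n)" "s \<noteq> of_int (- b - 2 * a * n)"
    unfolding s_def by (rule indefinite_sqrt_not_int[OF assms])+
  then show "X G \<noteq> of_int n" "X_conj G \<noteq> of_int n"
    using \<open>a \<noteq> 0\<close> unfolding G X.simps X_conj.simps s_def[unfolded G, symmetric]
    by (auto simp: field_simps)
qed

lemma X_shift:
  assumes "indefinite G"
  shows "X (shift q G) = X G - of_int q" "X_conj (shift q G) = X_conj G - of_int q"
proof -
  obtain a b c where G: "G = (a, b, c)" by (cases G)
  have a: "a \<noteq> 0" using assms indefinite_coeffs_nonzero G by blast
  have d: "discr (a, b + 2 * a * q, c + q * (b + a * q)) = discr (a, b, c)"
    using discr_shift[of q "(a, b, c)"] by (simp only: shift.simps)
  show "X (shift q G) = X G - of_int q" "X_conj (shift q G) = X_conj G - of_int q"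
    unfolding G shift.simps X.simps X_conj.simps d
    using a by (simp_all add: field_simps del: discr.simps)
qed

text \<open>Rationalising the denominator: \<open>(s - b) * (s + b) = - 4 * a * c\<close> for the
  square root \<open>s\<close> of the discriminant.\<close>

lemma X_flip:
  assumes "indefinite G"
  shows "X (flip G) = 1 / X G" "X_conj (flip G) = 1 / X_conj G"
proof -
  obtain a b c where G: "G = (a, b, c)" by (cases G)
  define s where "s = sqrt (real_of_int (discr (a, b, c)))"
  have ac: "a \<noteq> 0" "c \<noteq> 0" using assms indefinite_coeffs_nonzero G by blast+
  have d: "discr (- c, - b, - a) = discr (a, b, c)" by simp
  have s2: "s * s = of_int b * of_int b - 4 * of_int a * of_int c"
    using indefinite_sqrt_square[of a b c] assms
    by (simp add: s_def G power2_eq_square del: discr.simps)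
  \<comment> \<open>Both roots are nonzero, so they can be inverted.\<close>
  have s: "s \<noteq> of_int b" "s \<noteq> of_int (- b)"
    unfolding s_def G[symmetric] by (rule indefinite_sqrt_not_int[OF assms])+
  then have "s - of_int b \<noteq> 0" "- s - of_int b \<noteq> 0" by auto
  then show "X (flip G) = 1 / X G" "X_conj (flip G) = 1 / X_conj G"
    unfolding G flip.simps X.simps X_conj.simps d s_def[symmetric]
    using ac s2 by (simp_all add: divide_simps) (simp_all add: algebra_simps)
qed

lemma X_K_successor:
  assumes "indefinite G"
  shows "X (K_successor G) = 1 / X G - \<lfloor>1 / X G\<rfloor>"
    and "X_conj (K_successor G) = 1 / X_conj G - \<lfloor>1 / X G\<rfloor>"
proof -
  have "indefinite (flip G)" using assms by (simp add: indefinite_def)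
  then show "X (K_successor G) = 1 / X G - \<lfloor>1 / X G\<rfloor>"
    and "X_conj (K_successor G) = 1 / X_conj G - \<lfloor>1 / X G\<rfloor>"
    using assms by (simp_all add: K_successor_eq_shift_flip X_shift X_flip)
qed

section \<open>Location of the roots and K-reducedness\<close>

lemma first_form_X_bounds:
  assumes "indefinite F"
  shows "0 < X (first_form F)" "X (first_form F) < 1"
proof -
  have "X (first_form F) = X F - of_int \<lfloor>X F\<rfloor>"
    using assms by (simp add: first_form_eq_shift X_shift)
  moreover have "X F \<noteq> of_int \<lfloor>X F\<rfloor>" using X_not_int assms by blast
  ultimately show "0 < X (first_form F)" "X (first_form F) < 1" by linarith+
qed

lemma K_successor_X_bounds:
  assumes "indefinite G"
  shows "0 < X (K_successor G)" "X (K_successor G) < 1"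
proof -
  have "X (K_successor G) \<noteq> of_int 0" using X_not_int assms by (metis indefinite_K_successor)
  then show "0 < X (K_successor G)" "X (K_successor G) < 1"
    using X_K_successor(1)[OF assms] by simp_all linarith+
qed

text \<open>Let \<open>a > 0\<close>. Then \<open>0 < X\<close> reads \<open>b < s\<close>, and
  \<open>X < 1\<close> reads \<open>s < b + 2 * a\<close>. The condition on the conjugate root reads
  \<open>2 * a < s + b\<close>; multiplied by \<open>s - b > 0\<close> it becomes
  \<open>s < b + 2 * \<bar>c\<bar>\<close>, since
  \<open>(s - b) * (s + b) = 4 * a * \<bar>c\<bar>\<close>. For \<open>a < 0\<close> the roots lie
  in the wrong order and both sides fail.\<close>

lemma K_reduced_iff_roots:
  "K_reduced G \<longleftrightarrow> indefinite G \<and> 0 < X G \<and> X G < 1 \<and> X_conj G < - 1"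
proof (cases "indefinite G")
  case False
  then show ?thesis by (cases G) simp
next
  case True
  obtain a b c where G: "G = (a, b, c)" by (cases G)
  define s where "s = sqrt (real_of_int (discr (a, b, c)))"
  have ac: "a \<noteq> 0" "c \<noteq> 0" using True indefinite_coeffs_nonzero G by blast+
  have s2: "(s - of_int b) * (s + of_int b) = - 4 * of_int a * of_int c"
    using indefinite_sqrt_square[of a b c] True
    by (simp add: s_def G power2_eq_square algebra_simps del: discr.simps)
  have spos: "s > 0" using True by (simp add: s_def G indefinite_def del: discr.simps)
  have sb: "s \<noteq> of_int b"
    using indefinite_sqrt_not_int[OF True] s_def G by auto
  \<comment> \<open>The floor of \<open>s\<close> can be replaced by \<open>s\<close> because it is
    compared with integers only; \<open>b \<le> s\<close> becomes strict because \<open>s\<close> is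
    irrational.\<close>
  have red: "K_reduced G \<longleftrightarrow> a > 0 \<and> b > 0 \<and> s < of_int b + 2 * of_int a
      \<and> s < of_int b + 2 * of_int \<bar>c\<bar> \<and> of_int b < s"
  proof -
    have "\<lfloor>s\<rfloor> - min (2 * a) (2 * \<bar>c\<bar>) < b \<longleftrightarrow> \<lfloor>s\<rfloor> < b + 2 * a \<and> \<lfloor>s\<rfloor> < b + 2 * \<bar>c\<bar>"
      by linarith
    then show ?thesis
      using True sb unfolding G K_reduced.simps s_def[symmetric] Let_def
      by (auto simp: floor_less_iff le_floor_iff simp del: of_int_abs)
  qed
  show ?thesis
  proof (cases "a > 0")
    case True
    then have apos: "0 < real_of_int a" by simp
    have X: "0 < X G \<longleftrightarrow> of_int b < s" "X G < 1 \<longleftrightarrow> s < of_int b + 2 * of_int a"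
      "X_conj G < - 1 \<longleftrightarrow> 2 * of_int a < s + of_int b"
      unfolding G X.simps X_conj.simps s_def[symmetric] using apos by (auto simp: field_simps)
    show ?thesis
    proof (cases "of_int b < s \<and> s < of_int b + 2 * of_int a")
      case False
      then show ?thesis unfolding red X by auto
    next
      case bs: True
      \<comment> \<open>The premise forces \<open>c < 0\<close>, so that
        \<open>\<bar>c\<bar> = - c\<close>.\<close>
      have conj_iff: "2 * of_int a < s + of_int b \<longleftrightarrow> s < of_int b + 2 * of_int \<bar>c\<bar>"
        if "0 < s + of_int b"
      proof -
        have "0 < (s - of_int b) * (s + of_int b)" using that bs by simp
        then have "of_int c < (0::real)" using s2 apos by (simp add: zero_less_mult_iff mult_less_0_iff)
        then have m: "(s - of_int b) * (s + of_int b) = 2 * of_int a * (2 * of_int \<bar>c\<bar>)"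
          using s2 by simp
        have "2 * of_int a < s + of_int b
            \<longleftrightarrow> (s - of_int b) * (2 * of_int a) < (s - of_int b) * (s + of_int b)"
          using bs by (simp add: mult_less_cancel_left)
        also have "\<dots> \<longleftrightarrow> 2 * of_int a * (s - of_int b) < 2 * of_int a * (2 * of_int \<bar>c\<bar>)"
          unfolding m by (simp add: mult.commute)
        also have "\<dots> \<longleftrightarrow> s - of_int b < 2 * of_int \<bar>c\<bar>"
          using apos by (intro mult_less_cancel_left_pos) simp
        finally show ?thesis by linarith
      qed
      \<comment> \<open>Adding \<open>s < b + 2 * a\<close> to \<open>2 * a < s + b\<close> gives
        \<open>0 < 2 * b\<close>. Either side of the equivalence thus yields the premise of
        \<open>conj_iff\<close>.\<close>
      have "0 < b" if "2 * of_int a < s + of_int b"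
        using that bs by linarith
      moreover have "0 < s + of_int b" if "0 < b" using that spos by (simp add: add_pos_pos)
      moreover have "0 < s + of_int b" if "2 * of_int a < s + of_int b" using that apos by linarith
      ultimately show ?thesis
        unfolding red X using bs conj_iff True \<open>indefinite G\<close> by blast
    qed
  next
    case False
    then have "real_of_int a < 0" using ac by simp
    then have "X G < X_conj G"
      unfolding G X.simps X_conj.simps s_def[symmetric] using spos by (simp add: field_simps)
    then show ?thesis using red False by auto
  qed
qed

section \<open>Dynamics of the K-successor map\<close>

lemma floor_inverse_X_ge_1:
  assumes "0 < X G" "X G < 1"
  shows "1 \<le> \<lfloor>1 / X G\<rfloor>"
  using assms by (simp add: le_floor_iff)

text \<open>The inverse of the conjugate root is negative, and the integer subtracted from it is at
  least 1.\<close>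

lemma K_reduced_K_successor_if_X_conj_neg:
  assumes "indefinite G" "0 < X G" "X G < 1" "X_conj G < 0"
  shows "K_reduced (K_successor G)"
proof -
  have "1 / X_conj G < 0" using assms by simp
  then have "X_conj (K_successor G) < - 1"
    using floor_inverse_X_ge_1[OF assms(2,3)] X_K_successor(2)[OF assms(1)] by linarith
  then show ?thesis
    using assms K_successor_X_bounds by (simp add: K_reduced_iff_roots)
qed

lemma K_reduced_K_successor:
  assumes "K_reduced G"
  shows "K_reduced (K_successor G)"
  using assms by (intro K_reduced_K_successor_if_X_conj_neg) (auto simp: K_reduced_iff_roots)

lemma inj_on_K_successor: "inj_on K_successor {G. K_reduced G}"
proof (rule inj_onI)
  \<comment> \<open>The inverse of the conjugate root lies strictly between -1 and 0, so
    \<open>- X_conj (K_successor G)\<close> lies strictly between \<open>q\<close> and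
    \<open>q + 1\<close> for the integer \<open>q\<close> used in the step.\<close>
  have q: "\<lfloor>- X_conj (K_successor G)\<rfloor> = \<lfloor>1 / X G\<rfloor>" if "K_reduced G" for G
  proof -
    have "indefinite G" "X_conj G < - 1" using that by (auto simp: K_reduced_iff_roots)
    moreover from this have "- 1 < 1 / X_conj G" "1 / X_conj G < 0" by (auto simp: field_simps)
    ultimately show ?thesis
      using X_K_successor(2)[of G] by linarith
  qed
  fix G H
  assume "G \<in> {G. K_reduced G}" "H \<in> {G. K_reduced G}" and eq: "K_successor G = K_successor H"
  then have "\<lfloor>1 / X G\<rfloor> = \<lfloor>1 / X H\<rfloor>" using q by (metis mem_Collect_eq)
  then have "flip G = flip H"
    using eq inj_shift by (metis K_successor_eq_shift_flip injD)
  then show "G = H" using inj_flip by (auto dest: injD)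
qed

text \<open>From \<open>0 < b\<close> and \<open>b^2 \<le> D\<close> follows \<open>c < 0\<close>;
  then \<open>D = b^2 + 4 * a * \<bar>c\<bar>\<close> is a sum of positive terms and bounds every
  coefficient.\<close>

lemma finite_K_reduced: "finite {G. K_reduced G \<and> discr G = D}"
proof (rule finite_subset)
  show "{G. K_reduced G \<and> discr G = D} \<subseteq> {0..D} \<times> {0..D} \<times> {- D..D}"
  proof
    fix G assume G: "G \<in> {G. K_reduced G \<and> discr G = D}"
    obtain a b c where abc: "G = (a, b, c)" by (cases G)
    have red: "K_reduced (a, b, c)" and D: "D = discr (a, b, c)"
      using G abc by auto
    have ind: "indefinite (a, b, c)" and ab: "a > 0" "b > 0"
      and "b \<le> \<lfloor>sqrt (of_int D)\<rfloor>"
      using red unfolding K_reduced.simps D Let_def by auto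
    then have "of_int b \<le> sqrt (of_int D)" by (simp add: le_floor_iff)
    then have "(of_int b)\<^sup>2 \<le> real_of_int D"
      using ab by (metis real_le_rsqrt real_sqrt_ge_0_iff less_imp_le of_int_0_le_iff
          order_trans real_sqrt_le_iff real_sqrt_pow2 power_mono)
    then have "real_of_int (b\<^sup>2) \<le> real_of_int D" by simp
    then have bD: "b\<^sup>2 \<le> D" by (simp only: of_int_le_iff)
    have b: "b \<le> b\<^sup>2" using ab by (simp add: power2_eq_square)
    have c0: "c \<noteq> 0" using ind indefinite_coeffs_nonzero by blast
    have "a * c \<le> 0" using bD D by simp
    then have c: "c < 0" using ab c0 by (simp add: mult_le_0_iff)
    have "D = b\<^sup>2 + 4 * (a * - c)" using D by simp
    moreover have "a \<le> a * - c" using ab c mult_left_mono[of 1 "- c" a] by simp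
    moreover have "- c \<le> a * - c" using ab c mult_right_mono[of 1 a "- c"] by simp
    ultimately have "a \<le> D" "- c \<le> D" using b ab by linarith+
    then show "G \<in> {0..D} \<times> {0..D} \<times> {- D..D}"
      using ab b bD c by (simp add: abc)
  qed
qed simp

text \<open>Induction on the absolute value of the first coefficient. The first coefficient of the
  K-successor is \<open>- c\<close>, and the roots have product \<open>c / a\<close>.\<close>

lemma ex_K_reduced_iterate:
  assumes "indefinite G" "0 < X G" "X G < 1"
  shows "\<exists>k. K_reduced ((K_successor ^^ k) G)"
  using assms
proof (induction "nat \<bar>fst G\<bar>" arbitrary: G rule: less_induct)
  case less
  obtain a b c where G: "G = (a, b, c)" by (cases G)
  have ac: "a \<noteq> 0" "c \<noteq> 0" using less.prems(1) indefinite_coeffs_nonzero G by blast+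
  have succ: "indefinite (K_successor G)" "0 < X (K_successor G)" "X (K_successor G) < 1"
    using less.prems(1) K_successor_X_bounds by auto
  have neq: "X_conj G \<noteq> 0" "X_conj G \<noteq> 1"
    using X_not_int(2)[OF less.prems(1), of 0] X_not_int(2)[OF less.prems(1), of 1] by auto
  consider "X_conj G < 0" | "X_conj G > 1" | "0 < X_conj G" "X_conj G < 1"
    using neq by linarith
  then show ?case
  proof cases
    case 1
    then have "K_reduced ((K_successor ^^ 1) G)"
      using K_reduced_K_successor_if_X_conj_neg less.prems by simp
    then show ?thesis ..
  next
    case 2
    \<comment> \<open>Subtracting an integer that is at least 1 makes the conjugate root negative,
      which leads back to the first case after one step.\<close>
    then have "1 / X_conj G < 1" by simp
    then have "X_conj (K_successor G) < 0"
      using floor_inverse_X_ge_1[OF less.prems(2,3)] X_K_successor(2)[OF less.prems(1)] by linarith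
    then have "K_reduced ((K_successor ^^ 2) G)"
      using K_reduced_K_successor_if_X_conj_neg succ by (simp add: numeral_2_eq_2)
    then show ?thesis ..
  next
    case 3
    define s where "s = sqrt (real_of_int (discr (a, b, c)))"
    have s2: "s * s = of_int b * of_int b - 4 * of_int a * of_int c"
      using indefinite_sqrt_square[of a b c] less.prems(1)
      by (simp add: s_def G power2_eq_square del: discr.simps)
    have "X G * X_conj G = of_int c / of_int a"
      unfolding G X.simps X_conj.simps s_def[symmetric]
      using ac s2 by (simp add: divide_simps) (simp add: algebra_simps)
    moreover have "0 < X G * X_conj G" using 3 less.prems by simp
    moreover have "X G * X_conj G < 1" using 3 less.prems mult_strict_mono[of "X G" 1 "X_conj G" 1] by simp
    ultimately have "\<bar>of_int c / real_of_int a\<bar> < 1" by simp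
    then have "\<bar>real_of_int c\<bar> < \<bar>real_of_int a\<bar>" using ac by (simp add: divide_simps)
    then have "\<bar>c\<bar> < \<bar>a\<bar>" by linarith
    then have "nat \<bar>fst (K_successor G)\<bar> < nat \<bar>fst G\<bar>"
      by (simp add: G Let_def)
    from less.hyps[OF this succ] obtain k where "K_reduced ((K_successor ^^ k) (K_successor G))" ..
    then have "K_reduced ((K_successor ^^ Suc k) G)" by (simp add: funpow_swap1)
    then show ?thesis ..
  qed
qed

text \<open>By the pigeonhole principle some value repeats; injectivity of \<open>f\<close> allows
  both occurrences to be traced back until the earlier one sits at index \<open>N\<close>, so there
  is no preperiod after \<open>N\<close>.\<close>

lemma inj_on_orbit_returns:
  fixes s :: "nat \<Rightarrow> 'a"
  assumes "finite S" and "inj_on f S"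
    and mem: "\<And>j. j \<ge> N \<Longrightarrow> s j \<in> S"
    and step: "\<And>j. j \<ge> N \<Longrightarrow> s (Suc j) = f (s j)"
  obtains p where "p \<ge> 1" "\<And>j. j \<ge> N \<Longrightarrow> s (j + p) = s j"
proof -
  have "\<not> inj_on s {N..}"
    using finite_imageD[of s "{N..}"] finite_subset[of "s ` {N..}" S] assms(1) mem infinite_Ici
    by auto
  then obtain i j where ij: "N \<le> i" "i < j" "s i = s j"
    unfolding inj_on_def by (metis atLeast_iff linorder_neqE_nat)
  define p where "p = j - i"
  \<comment> \<open>Each induction step cancels one application of \<open>f\<close>; the lemma is
    used with \<open>k = i - N\<close>.\<close>
  have descend: "s (N + k + p) = s (N + k) \<Longrightarrow> s (N + p) = s N" for k
  proof (induction k)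
    case (Suc k)
    then have "f (s (N + k + p)) = f (s (N + k))"
      using step[of "N + k + p"] step[of "N + k"] by simp
    then have "s (N + k + p) = s (N + k)"
      using assms(2) mem by (simp add: inj_on_eq_iff)
    then show ?case using Suc.IH by blast
  qed simp
  have "s (N + (i - N) + p) = s (N + (i - N))" using ij by (simp add: p_def)
  then have base: "s (N + p) = s N" by (rule descend)
  have "s (j + p) = s j" if "j \<ge> N" for j
    using that by (induction j rule: dec_induct) (simp_all add: base step)
  then show thesis using that[of p] ij by (simp add: p_def)
qed

section \<open>Periodicity of the sequence of forms and the start of its period\<close>

theorem mainTheorem2:
  fixes F :: bqf and G :: "nat \<Rightarrow> bqf"
  assumes "indefinite F"
    and "G 1 = first_form F"
    and "\<And>j. j \<ge> 1 \<Longrightarrow> G (j + 1) = K_successor (G j)"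
  shows "(\<forall>j\<ge>1. indefinite (G j)) \<and>
    eventually_periodic G \<and>
    (\<forall>H\<in>set (period G). K_reduced H) \<and>
    (\<exists>j\<ge>1. K_reduced (G j)) \<and>
    period_start G = (LEAST j. 1 \<le> j \<and> K_reduced (G j))"
proof -
  have step: "G (Suc j) = K_successor (G j)" if "j \<ge> 1" for j
    using assms(3)[OF that] by simp
  have inv: "indefinite (G j) \<and> discr (G j) = discr F" if "j \<ge> 1" for j
    using that
    by (induction j rule: dec_induct) (use assms(1,2) step in \<open>auto simp: first_form_eq_shift\<close>)
  \<comment> \<open>The sequence starts at index 1, hence the offset between index and number of
    iterations.\<close>
  have iter: "G (1 + k) = (K_successor ^^ k) (G 1)" for k
    by (induction k) (simp_all add: step)
  obtain k where "K_reduced ((K_successor ^^ k) (G 1))"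
    using ex_K_reduced_iterate[of "G 1"] inv[of 1] first_form_X_bounds[OF assms(1)] assms(2) by auto
  then have "K_reduced (G (1 + k))" by (simp only: iter)
  then have ex: "\<exists>j. 1 \<le> j \<and> K_reduced (G j)" by (intro exI[of _ "1 + k"]) simp
  define N where "N = (LEAST j. 1 \<le> j \<and> K_reduced (G j))"
  have N: "1 \<le> N" "K_reduced (G N)"
    using LeastI_ex[OF ex] by (auto simp: N_def)
  have red: "K_reduced (G j)" if "j \<ge> N" for j
    using that by (induction j rule: dec_induct) (use N step K_reduced_K_successor in auto)
  obtain p where p: "p \<ge> 1" "\<And>j. j \<ge> N \<Longrightarrow> G (j + p) = G j"
  proof (rule inj_on_orbit_returns[of "{H. K_reduced H \<and> discr H = discr F}" K_successor N G])
    show "finite {H. K_reduced H \<and> discr H = discr F}" by (rule finite_K_reduced)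
    show "inj_on K_successor {H. K_reduced H \<and> discr H = discr F}"
      by (rule inj_on_subset[OF inj_on_K_successor]) auto
  qed (use red inv N step in auto)
  have per: "periodic_from G N p" using p N by (simp add: periodic_from_def)
  \<comment> \<open>If the sequence is periodic from \<open>m\<close> with period \<open>r\<close>,
    then \<open>G m\<close> recurs at index \<open>m + N * r\<close>, which is at least
    \<open>N\<close> because \<open>r \<ge> 1\<close>. All forms from \<open>N\<close> on are
    K-reduced, so \<open>G m\<close> is K-reduced and the minimality of \<open>N\<close>
    applies.\<close>
  have min: "N \<le> m" if "periodic_from G m r" for m r
  proof -
    have m: "1 \<le> m" "1 \<le> r" "\<And>j. j \<ge> m \<Longrightarrow> G (j + r) = G j"
      using that by (auto simp: periodic_from_def)
    have "G (m + n * r) = G m" for n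
    proof (induction n)
      case (Suc n)
      then show ?case using m(3)[of "m + n * r"] by (simp add: algebra_simps)
    qed simp
    moreover have "K_reduced (G (m + N * r))"
      using m(2) by (intro red) (simp add: trans_le_add2)
    ultimately have "K_reduced (G m)" by metis
    then show ?thesis unfolding N_def using m(1) by (intro Least_le) simp
  qed
  have start: "period_start G = N"
    unfolding period_start_def using per min by (intro Least_equality) auto
  have "K_reduced H" if "H \<in> set (period G)" for H
    using that red by (auto simp: period_def start)
  then show ?thesis
    using inv per ex start by (auto simp: eventually_periodic_def N_def)
qed

end
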